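(* Let $\Gamma$ be a $BPL$-theory (a set of $BPL$-formulas). Then $\Gamma$ is satisfiable in the class of pointed probability models if and only if every finite subset of $\Gamma$ is satisfiable in that class.
   Context: Fix a countable set $\mathcal{P}$ of propositional variables. $BPL$-formulas: $\varphi::= p\mid\neg p\mid\varphi\wedge\varphi\mid\varphi\vee\varphi\mid L_r\varphi$ with $p\in\mathcal{P}$, $r\in\mathbb{Q}\cap[0,1]$. A probability model is $\mathfrak{M}=(\Omega,\mathcal{A},T,v)$ where $\mathcal{A}$ is a $\sigma$-algebra on $\Omega\neq\emptyset$, $T$ assigns to each $w\in\Omega$ a $\sigma$-additive probability measure $T(w)$ on $\mathcal{A}$, with $\{w: T(w)(E)\ge r\}\in\mathcal{A}$ for all $E\in\mathcal{A}$, $r\in\mathbb{Q}\cap[0,1]$, and $v:\mathcal{P}\to\mathcal{A}$. A pointed model is $(\mathfrak{M},w)$ with $w\in\Omega$. Satisfaction: $\mathfrak{M},w\models p$ iff $w\in v(p)$; Boolean connectives as usual; $\mathfrak{M},w\models L_r\varphi$ iff $T(w)(\{u:\mathfrak{M},u\models\varphi\})\ge r$. A theory is satisfiable in a class if some pointed model in the class satisfies all its formulas. *)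

theory Defs
  imports "HOL-Probability.Probability"
begin

typedef prob_rat = "{r :: rat. 0 \<le> r \<and> r \<le> 1}"
  morphisms rat_of_prob_rat Prob_rat
  by (rule exI[of _ 0]) simp

abbreviation threshold :: "prob_rat \<Rightarrow> real" where
  "threshold r \<equiv> real_of_rat (rat_of_prob_rat r)"

text \<open>Negation is available on propositional variables only.\<close>

datatype 'p bpl =
    Var 'p
  | NegVar 'p
  | Conj "'p bpl" "'p bpl"
  | Disj "'p bpl" "'p bpl"
  | L prob_rat "'p bpl"

record ('w, 'p) model_data =
  points :: "'w set"
  events :: "'w set set"
  kern :: "'w \<Rightarrow> 'w measure"
  val :: "'p \<Rightarrow> 'w set"

definition probability_model :: "('w, 'p) model_data \<Rightarrow> bool" where
  "probability_model M \<longleftrightarrow>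
     points M \<noteq> {} \<and>
     sigma_algebra (points M) (events M) \<and>
     (\<forall>w\<in>points M. prob_space (kern M w) \<and>
        space (kern M w) = points M \<and> sets (kern M w) = events M) \<and>
     (\<forall>E\<in>events M. \<forall>r. {w \<in> points M. measure (kern M w) E \<ge> threshold r} \<in> events M) \<and>
     (\<forall>p. val M p \<in> events M)"

primrec sat :: "('w, 'p) model_data \<Rightarrow> 'w \<Rightarrow> 'p bpl \<Rightarrow> bool" where
  "sat M w (Var p) \<longleftrightarrow> w \<in> val M p"
| "sat M w (NegVar p) \<longleftrightarrow> w \<notin> val M p"
| "sat M w (Conj \<phi> \<psi>) \<longleftrightarrow> sat M w \<phi> \<and> sat M w \<psi>"
| "sat M w (Disj \<phi> \<psi>) \<longleftrightarrow> sat M w \<phi> \<or> sat M w \<psi>"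
| "sat M w (L r \<phi>) \<longleftrightarrow> measure (kern M w) {u \<in> points M. sat M u \<phi>} \<ge> threshold r"

definition satisfiable_over :: "'w itself \<Rightarrow> 'p bpl set \<Rightarrow> bool" where
  "satisfiable_over _ \<Gamma> \<longleftrightarrow>
     (\<exists>(M :: ('w, 'p) model_data) w.
        probability_model M \<and> w \<in> points M \<and> (\<forall>\<phi>\<in>\<Gamma>. sat M w \<phi>))"

text \<open>
  HOL cannot quantify over the type of points inside a definition, so satisfiability in the
  class of all pointed models is expressed with a type of points that is large enough:
  sets of formulas. This loses no generality: by \<open>satisfiable_over_imp_satisfiable\<close>
  below, a theory that has a pointed model over any type whatsoever is satisfiable in this sense.
\<close>

definition satisfiable :: "'p bpl set \<Rightarrow> bool" where
  "satisfiable \<Gamma> \<longleftrightarrow> satisfiable_over TYPE('p bpl set) \<Gamma>"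

lemma threshold_range: "0 \<le> threshold r" "threshold r \<le> 1"
  using rat_of_prob_rat[of r] by auto

lemma threshold_Prob_rat: "0 \<le> q \<Longrightarrow> q \<le> 1 \<Longrightarrow> threshold (Prob_rat q) = real_of_rat q"
  by (simp add: Prob_rat_inverse)

lemma sat_set_in_events:
  assumes "probability_model M"
  shows "{u \<in> points M. sat M u \<phi>} \<in> events M"
proof -
  interpret sigma_algebra "points M" "events M"
    using assms by (simp add: probability_model_def)
  have val: "val M p \<in> events M" for p
    using assms by (simp add: probability_model_def)
  show ?thesis
  proof (induction \<phi>)
    case (Var p)
    have "{u \<in> points M. sat M u (Var p)} = val M p"
      using sets_into_space[OF val[of p]] by auto
    then show ?case using val by simp
  next
    case (NegVar p)
    have "{u \<in> points M. sat M u (NegVar p)} = points M - val M p" by auto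
    then show ?case using compl_sets[OF val] by simp
  next
    case (Conj \<phi> \<psi>)
    have "{u \<in> points M. sat M u (Conj \<phi> \<psi>)} =
        {u \<in> points M. sat M u \<phi>} \<inter> {u \<in> points M. sat M u \<psi>}" by auto
    then show ?case using Int[OF Conj.IH] by simp
  next
    case (Disj \<phi> \<psi>)
    have "{u \<in> points M. sat M u (Disj \<phi> \<psi>)} =
        {u \<in> points M. sat M u \<phi>} \<union> {u \<in> points M. sat M u \<psi>}" by auto
    then show ?case using Un[OF Disj.IH] by simp
  next
    case (L r \<phi>)
    then show ?case using assms by (simp add: probability_model_def)
  qed
qed

lemma satisfiable_over_imp_satisfiable:
  fixes \<Gamma> :: "'p bpl set"
  assumes "satisfiable_over TYPE('w) \<Gamma>"
  shows "satisfiable \<Gamma>"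
proof -
  obtain M :: "('w, 'p) model_data" and w where
    M: "probability_model M" and w: "w \<in> points M" and w_sat: "\<forall>\<phi>\<in>\<Gamma>. sat M w \<phi>"
    using assms unfolding satisfiable_over_def by blast
  have prob: "prob_space (kern M u)" and space_T: "space (kern M u) = points M"
    and sets_T: "sets (kern M u) = events M" if "u \<in> points M" for u
    using M that by (auto simp: probability_model_def)
  have ev: "{u \<in> points M. sat M u \<phi>} \<in> events M" for \<phi>
    by (rule sat_set_in_events[OF M])

  define th where "th u = {\<phi>. sat M u \<phi>}" for u
  define X where "X = th ` points M"
  define B where "B \<phi> = {t \<in> X. \<phi> \<in> t}" for \<phi>
  define G where "G = range B"
  define S where "S = sigma X G"
  define K where "K t = distr (kern M (inv_into (points M) th t)) S th" for t
  have G_Pow: "G \<subseteq> Pow X" by (auto simp: G_def B_def)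
  have space_S: "space S = X" and sets_S: "sets S = sigma_sets X G"
    using G_Pow by (auto simp: S_def)
  have B_S: "B \<phi> \<in> sets S" for \<phi> by (auto simp: sets_S G_def)
  have Int_G: "Int_stable G"
  proof (rule Int_stableI)
    fix a b assume "a \<in> G" "b \<in> G"
    then obtain \<phi> \<psi> where "a = B \<phi>" "b = B \<psi>" by (auto simp: G_def)
    then have "a \<inter> b = B (Conj \<phi> \<psi>)" by (auto simp: B_def X_def th_def)
    then show "a \<inter> b \<in> G" by (simp add: G_def)
  qed
  have vimage_B: "th -` B \<phi> \<inter> points M = {u \<in> points M. sat M u \<phi>}" for \<phi>
    by (auto simp: B_def X_def th_def)
  have th_meas: "th \<in> kern M u \<rightarrow>\<^sub>M S" if "u \<in> points M" for u
    unfolding S_def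
  proof (rule measurable_measure_of[OF G_Pow])
    show "th \<in> space (kern M u) \<rightarrow> X"
      using that by (auto simp: X_def space_T)
    fix y assume "y \<in> G"
    then show "th -` y \<inter> space (kern M u) \<in> sets (kern M u)"
      using that ev by (auto simp: G_def space_T sets_T vimage_B)
  qed
  have distr_B: "measure (distr (kern M u) S th) (B \<phi>) =
      measure (kern M u) {v \<in> points M. sat M v \<phi>}" if "u \<in> points M" for u \<phi>
    using that by (simp add: measure_distr[OF th_meas B_S] space_T vimage_B)
  have inv_X: "inv_into (points M) th t \<in> points M" "th (inv_into (points M) th t) = t"
    if "t \<in> X" for t
    using that unfolding X_def by (rule inv_into_into, rule f_inv_into_f)
  have K_prob: "prob_space (K t)" if "t \<in> X" for t
    unfolding K_def using that by (intro prob_space.prob_space_distr prob th_meas inv_X)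
  have K_sets: "sets (K t) = sets S" for t by (simp add: K_def)
  have K_B: "measure (K t) (B \<phi>) \<ge> threshold r \<longleftrightarrow> L r \<phi> \<in> t" if "t \<in> X" for t r \<phi>
  proof -
    have "L r \<phi> \<in> t \<longleftrightarrow> sat M (inv_into (points M) th t) (L r \<phi>)"
      using inv_X(2)[OF that] unfolding th_def by blast
    then show ?thesis using inv_X(1)[OF that] by (simp add: K_def distr_B)
  qed

  have K_meas: "K \<in> S \<rightarrow>\<^sub>M prob_algebra S"
  proof (rule measurable_prob_algebra_generated[OF sets_S Int_G G_Pow])
    show "prob_space (K t)" if "t \<in> space S" for t
      using that K_prob by (simp add: space_S)
    show "sets (K t) = sets S" for t by (rule K_sets)
    fix E assume "E \<in> G"
    then obtain \<phi> where E: "E = B \<phi>" by (auto simp: G_def)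
    have le: "{t \<in> space S. real_of_rat q \<le> measure (K t) E} \<in> sets S" for q
    proof -
      consider "q < 0" | "0 \<le> q" "q \<le> 1" | "1 < q" by linarith
      then show ?thesis
      proof cases
        case 1
        then have "real_of_rat q \<le> measure (K t) E" for t
          by (meson measure_nonneg of_rat_less_0_iff less_le_trans less_imp_le)
        then show ?thesis by simp
      next
        case 2
        have "{t \<in> space S. real_of_rat q \<le> measure (K t) E} = B (L (Prob_rat q) \<phi>)"
          using K_B[of _ "Prob_rat q" \<phi>] threshold_Prob_rat[OF 2]
          by (auto simp: E space_S B_def)
        then show ?thesis using B_S by simp
      next
        case 3
        have "\<not> real_of_rat q \<le> measure (K t) E" if "t \<in> space S" for t
        proof -
          have "measure (K t) E \<le> 1"
            using K_prob that by (simp add: space_S prob_space.prob_le_1)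
          moreover have "1 < real_of_rat q" using 3 by simp
          ultimately show ?thesis by linarith
        qed
        then have "{t \<in> space S. real_of_rat q \<le> measure (K t) E} = {}" by blast
        then show ?thesis by (simp only: sets.empty_sets)
      qed
    qed
    have "(\<lambda>t. measure (K t) E) \<in> borel_measurable S"
    proof (rule borel_measurable_iff_greater[THEN iffD2], intro allI)
      fix a :: real
      have "{t \<in> space S. a < measure (K t) E} =
          (\<Union>q\<in>{q. a < real_of_rat q}. {t \<in> space S. real_of_rat q \<le> measure (K t) E})"
        using of_rat_dense[of a] by (fastforce intro: less_imp_le)
      then show "{t \<in> space S. a < measure (K t) E} \<in> sets S"
        using le by (auto intro!: sets.countable_UN')
    qed
    then have "(\<lambda>t. ennreal (measure (K t) E)) \<in> borel_measurable S" by simp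
    also have "(\<lambda>t. ennreal (measure (K t) E)) \<in> borel_measurable S \<longleftrightarrow>
        (\<lambda>t. emeasure (K t) E) \<in> borel_measurable S"
      by (rule measurable_cong)
        (use K_prob in \<open>simp add: space_S finite_measure.emeasure_eq_measure prob_space.finite_measure\<close>)
    finally show "(\<lambda>t. emeasure (K t) E) \<in> borel_measurable S" .
  qed

  define N :: "('p bpl set, 'p) model_data" where
    "N = \<lparr>points = X, events = sets S, kern = K, val = \<lambda>p. B (Var p)\<rparr>"
  have N: "probability_model N"
    unfolding probability_model_def
  proof (intro conjI ballI allI)
    show "points N \<noteq> {}" using w by (auto simp: N_def X_def)
    show "sigma_algebra (points N) (events N)"
      using sets.sigma_algebra_axioms[of S] by (simp add: N_def space_S)
    fix t assume t: "t \<in> points N"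
    show "prob_space (kern N t)" using t K_prob by (simp add: N_def)
    show "sets (kern N t) = events N" by (simp add: N_def K_sets)
    show "space (kern N t) = points N" by (simp add: N_def K_def space_S)
  next
    fix E r assume "E \<in> events N"
    then have [measurable]: "E \<in> sets S" by (simp add: N_def)
    have "K \<in> S \<rightarrow>\<^sub>M subprob_algebra S" by (rule measurable_prob_algebraD[OF K_meas])
    then have [measurable]: "(\<lambda>t. measure (K t) E) \<in> borel_measurable S"
      by (rule measurable_compose) (rule measurable_measure_subprob_algebra, simp)
    have "{t \<in> space S. threshold r \<le> measure (K t) E} \<in> sets S" by measurable
    then show "{t \<in> points N. threshold r \<le> measure (kern N t) E} \<in> events N"
      by (simp add: N_def space_S)
  next
    show "val N p \<in> events N" for p by (simp add: N_def B_S)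
  qed
  have truth: "sat N t \<phi> \<longleftrightarrow> \<phi> \<in> t" if "t \<in> X" for t \<phi>
    using that
  proof (induction \<phi> arbitrary: t)
    case (L r \<phi>)
    have "{s \<in> X. sat N s \<phi>} = B \<phi>" using L.IH by (auto simp: B_def)
    then show ?case using K_B[OF L.prems] by (simp add: N_def)
  qed (auto simp: N_def B_def X_def th_def)
  have "th w \<in> points N" "\<forall>\<phi>\<in>\<Gamma>. sat N (th w) \<phi>"
    using w w_sat truth[of "th w"] by (auto simp: N_def X_def th_def)
  with N show ?thesis unfolding satisfiable_def satisfiable_over_def by blast
qed

end

theory Submission
  imports Defs
begin

text \<open>
  Enumerate the theory and take models \<open>M n\<close> of its finite initial segments. On the product of
  their point sets, a sequence of events \<open>E n\<close> determines the internal set of those \<open>f\<close> with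
  \<open>f n \<in> E n\<close> for almost all \<open>n\<close> modulo a free ultrafilter. Internal sets form an algebra, and
  the limit of the measures of \<open>E n\<close> along the ultrafilter is a finitely additive probability on
  it; it is a premeasure because the free ultrafilter on the naturals makes the algebra countably
  saturated (the Loeb construction). Caratheodory extension yields the Markov kernel of the
  limit model. Truth of a formula almost everywhere implies truth in the limit model: as formulas
  are positive in \<open>L\<close>, and limits preserve non-strict inequalities, this one direction can be
  proved by induction on its own.
\<close>

section \<open>Ultrafilters and convergence along them\<close>

definition ultrafilter :: "'a filter \<Rightarrow> bool" where
  "ultrafilter U \<longleftrightarrow> U \<noteq> bot \<and> (\<forall>P. eventually P U \<or> eventually (\<lambda>x. \<not> P x) U)"

text \<open>Zorn's lemma yields a minimal proper filter below \<open>F\<close>. Minimality forces a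
  decision on each \<open>P\<close>: the meet with \<open>P\<close> is either \<open>bot\<close>, so
  that the negation of \<open>P\<close> holds eventually, or the filter itself.\<close>

lemma exists_ultrafilter_le:
  fixes F :: "'a filter"
  assumes "F \<noteq> bot"
  shows "\<exists>U\<le>F. ultrafilter U"
proof -
  define A where "A = {G. G \<noteq> bot \<and> G \<le> F}"
  have "\<exists>U\<in>A. \<forall>G\<in>A. G \<le> U \<longrightarrow> G = U"
  proof (rule predicate_Zorn)
    show "partial_order_on A (relation_of (\<lambda>a b. b \<le> a) A)"
      by (auto simp: partial_order_on_def preorder_on_def refl_on_def trans_def antisym_def
          relation_of_def)
    fix C assume C: "C \<in> Chains (relation_of (\<lambda>a b. b \<le> a) A)"
    then have sub: "C \<subseteq> A" by (auto simp: Chains_def relation_of_def)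
    show "\<exists>u\<in>A. \<forall>a\<in>C. u \<le> a"
    proof (cases "C = {}")
      case True
      then show ?thesis using assms by (auto simp: A_def)
    next
      case False
      \<comment> \<open>A chain is directed, so an event of \<open>Inf C\<close> is already an event
        of some member; hence \<open>Inf C\<close> is proper.\<close>
      have "\<exists>x\<in>C. x \<le> inf a b" if "a \<in> C" "b \<in> C" for a b
        using C that by (auto simp: Chains_def relation_of_def)
      from eventually_Inf_base[OF False this]
      have "eventually (\<lambda>_. False) (Inf C) \<longleftrightarrow> (\<exists>b\<in>C. eventually (\<lambda>_. False) b)" .
      then have "Inf C \<noteq> bot"
        using sub by (auto simp: A_def simp flip: trivial_limit_def)
      moreover have "Inf C \<le> F"
      proof -
        obtain G where "G \<in> C" "G \<le> F" using False sub by (auto simp: A_def)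
        then show ?thesis by (rule Inf_lower2)
      qed
      ultimately have "Inf C \<in> A" by (simp add: A_def)
      moreover have "\<forall>a\<in>C. Inf C \<le> a" by (intro ballI Inf_lower)
      ultimately show ?thesis by (rule bexI[rotated])
    qed
  qed
  then obtain U where U: "U \<noteq> bot" "U \<le> F"
    and min: "\<And>G. G \<noteq> bot \<Longrightarrow> G \<le> U \<Longrightarrow> G = U"
    by (auto simp: A_def)
  have "eventually P U \<or> eventually (\<lambda>x. \<not> P x) U" for P
  proof (cases "inf U (principal {x. P x}) = bot")
    case True
    then show ?thesis by (simp add: trivial_limit_def eventually_inf_principal)
  next
    case False
    then have "inf U (principal {x. P x}) = U" by (rule min) simp
    moreover have "eventually P (inf U (principal {x. P x}))"
      by (simp add: eventually_inf_principal)
    ultimately show ?thesis by simp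
  qed
  with U show ?thesis by (auto simp: ultrafilter_def)
qed

lemma ultrafilter_not_eventually:
  assumes "ultrafilter U"
  shows "(\<not> eventually P U) \<longleftrightarrow> eventually (\<lambda>x. \<not> P x) U"
proof -
  have "eventually (\<lambda>_. False) U" if "eventually P U" "eventually (\<lambda>x. \<not> P x) U"
    using that by eventually_elim simp
  then show ?thesis using assms by (auto simp: ultrafilter_def trivial_limit_def)
qed

lemma ultrafilter_eventually_disj:
  assumes "ultrafilter U"
  shows "eventually (\<lambda>x. P x \<or> Q x) U \<longleftrightarrow> eventually P U \<or> eventually Q U"
proof -
  have "\<not> eventually (\<lambda>x. P x \<or> Q x) U \<longleftrightarrow> \<not> eventually P U \<and> \<not> eventually Q U"
    by (simp add: ultrafilter_not_eventually[OF assms] eventually_conj_iff)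
  then show ?thesis by blast
qed

text \<open>Compactness gives the image filter a cluster point, and an ultrafilter converges to its
  cluster points: if it missed a neighbourhood \<open>T\<close>, it would eventually lie in the
  complement of \<open>T\<close>.\<close>

lemma ultrafilter_tendsto_compact:
  fixes g :: "'a \<Rightarrow> 'b::topological_space"
  assumes U: "ultrafilter U" and "compact S" and ev: "eventually (\<lambda>x. g x \<in> S) U"
  shows "\<exists>l\<in>S. (g \<longlongrightarrow> l) U"
proof -
  have "filtermap g U \<noteq> bot" "eventually (\<lambda>y. y \<in> S) (filtermap g U)"
    using U ev by (auto simp: ultrafilter_def filtermap_bot_iff eventually_filtermap)
  then obtain l where l: "l \<in> S" "inf (nhds l) (filtermap g U) \<noteq> bot"
    using \<open>compact S\<close> unfolding compact_filter by blast
  have "eventually (\<lambda>x. g x \<in> T) U" if "open T" "l \<in> T" for T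
  proof (rule ccontr)
    assume "\<not> eventually (\<lambda>x. g x \<in> T) U"
    then have "eventually (\<lambda>x. g x \<notin> T) U"
      by (simp add: ultrafilter_not_eventually[OF U])
    then have "eventually (\<lambda>y. y \<notin> T) (filtermap g U)" by (simp add: eventually_filtermap)
    moreover have "eventually (\<lambda>y. y \<in> T) (nhds l)"
      using that by (rule eventually_nhds_in_open)
    ultimately have "eventually (\<lambda>_. False) (inf (nhds l) (filtermap g U))"
      unfolding eventually_inf by blast
    with l show False by (simp add: trivial_limit_def)
  qed
  with l show ?thesis by (auto simp: tendsto_def)
qed

section \<open>The algebra of internal sets and its saturation\<close>

locale model_ultraproduct =
  fixes U :: "nat filter" and M :: "nat \<Rightarrow> ('w, 'p) model_data"
  assumes ultra: "ultrafilter U" and free: "U \<le> sequentially"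
    and models: "\<And>n. probability_model (M n)"
begin

text \<open>No quotient modulo \<open>U\<close> is formed: sequences in \<open>X\<close> that agree
  almost everywhere lie in the same internal sets and have the same
  \<open>lim_measure\<close>.\<close>

definition X :: "(nat \<Rightarrow> 'w) set" where
  "X = {f. \<forall>n. f n \<in> points (M n)}"

definition EV :: "(nat \<Rightarrow> 'w set) set" where
  "EV = {E. \<forall>n. E n \<in> events (M n)}"

definition internal :: "(nat \<Rightarrow> 'w set) \<Rightarrow> (nat \<Rightarrow> 'w) set" where
  "internal E = {f \<in> X. \<forall>\<^sub>F n in U. f n \<in> E n}"

definition lim_measure :: "(nat \<Rightarrow> 'w) \<Rightarrow> (nat \<Rightarrow> 'w set) \<Rightarrow> real" where
  "lim_measure f E = Lim U (\<lambda>n. measure (kern (M n) (f n)) (E n))"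

lemma U_nontrivial: "U \<noteq> bot"
  using ultra by (simp add: ultrafilter_def)

lemma sigma_algebra_events: "sigma_algebra (points (M n)) (events (M n))"
  using models[of n] by (simp add: probability_model_def)

lemma algebra_events: "algebra (points (M n)) (events (M n))"
  using sigma_algebra_events by (rule sigma_algebra.axioms)

lemma kern:
  assumes "w \<in> points (M n)"
  shows "prob_space (kern (M n) w)" "space (kern (M n) w) = points (M n)"
    "sets (kern (M n) w) = events (M n)"
  using models[of n] assms by (auto simp: probability_model_def)

lemma events_subset: "e \<in> events (M n) \<Longrightarrow> e \<subseteq> points (M n)"
  using algebra_events[of n] by (auto simp: algebra_iff_Un)

lemma EV_ops:
  assumes "E \<in> EV" "F \<in> EV"
  shows "(\<lambda>n. E n \<union> F n) \<in> EV" "(\<lambda>n. E n \<inter> F n) \<in> EV" "(\<lambda>n. E n - F n) \<in> EV"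
proof -
  have "E n \<union> F n \<in> events (M n) \<and> E n \<inter> F n \<in> events (M n) \<and> E n - F n \<in> events (M n)" for n
  proof -
    interpret algebra "points (M n)" "events (M n)" by (rule algebra_events)
    show ?thesis using assms by (auto simp: EV_def)
  qed
  then show "(\<lambda>n. E n \<union> F n) \<in> EV" "(\<lambda>n. E n \<inter> F n) \<in> EV" "(\<lambda>n. E n - F n) \<in> EV"
    by (auto simp: EV_def)
qed

lemma empty_EV: "(\<lambda>_. {}) \<in> EV" and points_EV: "(\<lambda>n. points (M n)) \<in> EV"
  using algebra.top[OF algebra_events] algebra_events by (auto simp: EV_def algebra_iff_Un)

text \<open>Since \<open>U\<close> decides every property, \<open>internal\<close> commutes with the
  finite Boolean operations. This makes the internal sets an algebra.\<close>

lemma internal_Un: "internal (\<lambda>n. E n \<union> F n) = internal E \<union> internal F"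
  by (auto simp: internal_def ultrafilter_eventually_disj[OF ultra])

lemma internal_Int: "internal (\<lambda>n. E n \<inter> F n) = internal E \<inter> internal F"
  by (auto simp: internal_def eventually_conj_iff)

lemma internal_Diff: "internal (\<lambda>n. E n - F n) = internal E - internal F"
  by (auto simp: internal_def eventually_conj_iff simp flip: ultrafilter_not_eventually[OF ultra])

lemma internal_empty: "internal (\<lambda>_. {}) = {}"
  using U_nontrivial by (auto simp: internal_def)

lemma internal_points: "internal (\<lambda>n. points (M n)) = X"
  by (auto simp: internal_def X_def)

lemma algebra_internal: "algebra X (internal ` EV)"
  unfolding algebra_iff_Un
proof (intro conjI ballI)
  show "internal ` EV \<subseteq> Pow X" by (auto simp: internal_def)
  show "{} \<in> internal ` EV" using internal_empty empty_EV by (metis imageI)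
  fix a assume a: "a \<in> internal ` EV"
  then show "X - a \<in> internal ` EV"
    using EV_ops(3)[OF points_EV] internal_Diff internal_points by (auto simp: image_iff) metis
  fix b assume "b \<in> internal ` EV"
  with a show "a \<union> b \<in> internal ` EV"
    using EV_ops(1) internal_Un by (auto simp: image_iff) metis
qed

text \<open>
  Countable saturation: the diagonal sequence \<open>f\<close> picks \<open>f n\<close> in as many of the first \<open>n\<close> sets
  as have a common point.
\<close>

lemma internal_saturated:
  fixes E :: "nat \<Rightarrow> nat \<Rightarrow> 'w set"
  assumes E: "\<And>k. E k \<in> EV" and nonempty: "\<And>k. (\<Inter>j\<le>k. internal (E j)) \<noteq> {}"
  shows "(\<Inter>k. internal (E k)) \<noteq> {}"
proof -
  \<comment> \<open>\<open>D 0 n\<close> is all of \<open>points (M n)\<close>, so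
    \<open>k = 0\<close> always qualifies in the definition of \<open>m\<close>, and the bound by
    \<open>n\<close> ensures that a greatest \<open>k\<close> exists.\<close>
  define D where "D k n = points (M n) \<inter> (\<Inter>j<k. E j n)" for k n
  define m where "m n = (GREATEST k. k \<le> n \<and> D k n \<noteq> {})" for n
  have "D 0 n \<noteq> {}" for n
    using models[of n] by (auto simp: D_def probability_model_def)
  then have m: "m n \<le> n \<and> D (m n) n \<noteq> {}" for n
    unfolding m_def using GreatestI_nat[of "\<lambda>k. k \<le> n \<and> D k n \<noteq> {}" 0 n] by simp
  have m_ge: "k \<le> m n" if "k \<le> n" "D k n \<noteq> {}" for k n
    unfolding m_def using that Greatest_le_nat[of "\<lambda>k. k \<le> n \<and> D k n \<noteq> {}" k n] by simp
  define f where "f n = (SOME w. w \<in> D (m n) n)" for n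
  have f: "f n \<in> D (m n) n" for n
    unfolding f_def using m[of n] by (simp add: some_in_eq)
  then have "f \<in> X" by (auto simp: X_def D_def)
  moreover have "\<forall>\<^sub>F n in U. f n \<in> E k n" for k
  proof -
    obtain g where g: "g \<in> (\<Inter>j\<le>k. internal (E j))" using nonempty by blast
    then have "g \<in> X" by (auto simp: internal_def)
    have "\<forall>\<^sub>F n in U. \<forall>j\<in>{..k}. g n \<in> E j n"
      by (intro eventually_ball_finite) (use g in \<open>auto simp: internal_def\<close>)
    \<comment> \<open>Freeness of \<open>U\<close> removes the bound by \<open>n\<close>. The index
      is \<open>Suc k\<close> because \<open>D k\<close> involves only the sets with index below
      \<open>k\<close>.\<close>
    moreover have "\<forall>\<^sub>F n in U. Suc k \<le> n"
      using free eventually_ge_at_top[of "Suc k"] by (rule filter_leD)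
    ultimately show ?thesis
    proof eventually_elim
      case (elim n)
      then have "g n \<in> D (Suc k) n" using \<open>g \<in> X\<close> by (auto simp: D_def X_def)
      then have "Suc k \<le> m n" using elim by (intro m_ge) auto
      then show ?case using f[of n] by (auto simp: D_def)
    qed
  qed
  ultimately have "f \<in> (\<Inter>k. internal (E k))" by (auto simp: internal_def)
  then show ?thesis by blast
qed

lemma internal_eq_emptyD:
  assumes "E \<in> EV" "internal E = {}"
  shows "\<forall>\<^sub>F n in U. E n = {}"
proof (rule ccontr)
  assume "\<not> (\<forall>\<^sub>F n in U. E n = {})"
  then have ev: "\<forall>\<^sub>F n in U. E n \<noteq> {}" by (simp add: ultrafilter_not_eventually[OF ultra])
  \<comment> \<open>Membership in \<open>X\<close> constrains every coordinate, so an arbitrary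
    point serves as default where \<open>E n\<close> is empty.\<close>
  have "\<exists>w. w \<in> points (M n) \<and> (E n \<noteq> {} \<longrightarrow> w \<in> E n)" for n
    using models[of n] assms(1) events_subset[of "E n" n]
    by (cases "E n = {}") (auto simp: probability_model_def EV_def)
  then obtain f where f: "\<And>n. f n \<in> points (M n)" "\<And>n. E n \<noteq> {} \<Longrightarrow> f n \<in> E n"
    by metis
  from ev have "\<forall>\<^sub>F n in U. f n \<in> E n" by eventually_elim (rule f)
  then have "f \<in> internal E" using f by (simp add: internal_def X_def)
  with assms show False by blast
qed

text \<open>An internal set determines its sequence of events almost everywhere, so the limit of the
  measures depends on the internal set alone.\<close>

lemma internal_eqD:
  assumes "E \<in> EV" "F \<in> EV" "internal E = internal F"
  shows "\<forall>\<^sub>F n in U. E n = F n"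
proof -
  have "\<forall>\<^sub>F n in U. E n - F n = {}"
    using internal_eq_emptyD[OF EV_ops(3)[OF assms(1,2)]] assms(3) by (simp add: internal_Diff)
  moreover have "\<forall>\<^sub>F n in U. F n - E n = {}"
    using internal_eq_emptyD[OF EV_ops(3)[OF assms(2,1)]] assms(3) by (simp add: internal_Diff)
  ultimately show ?thesis by eventually_elim blast
qed

section \<open>Limits of measures along the ultrafilter\<close>

lemma tendsto_lim_measure:
  assumes "f \<in> X"
  shows "((\<lambda>n. measure (kern (M n) (f n)) (E n)) \<longlongrightarrow> lim_measure f E) U"
proof -
  have "measure (kern (M n) (f n)) (E n) \<in> {0..1}" for n
    using assms kern(1)[of "f n" n] by (auto simp: X_def prob_space.prob_le_1)
  then obtain l where "((\<lambda>n. measure (kern (M n) (f n)) (E n)) \<longlongrightarrow> l) U"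
    using ultrafilter_tendsto_compact[OF ultra compact_Icc] by (meson always_eventually)
  moreover from this have "lim_measure f E = l"
    unfolding lim_measure_def using U_nontrivial by (intro tendsto_Lim)
  ultimately show ?thesis by simp
qed

lemma lim_measure_cong:
  assumes "f \<in> X" "E \<in> EV" "F \<in> EV" "internal E = internal F"
  shows "lim_measure f E = lim_measure f F"
proof -
  have "\<forall>\<^sub>F n in U. measure (kern (M n) (f n)) (E n) = measure (kern (M n) (f n)) (F n)"
    using internal_eqD[OF assms(2-4)] by eventually_elim simp
  then have "((\<lambda>n. measure (kern (M n) (f n)) (F n)) \<longlongrightarrow> lim_measure f E) U"
    using tendsto_lim_measure[OF assms(1)] by (rule Lim_transform_eventually[rotated])
  then show ?thesis
    by (rule tendsto_unique[OF U_nontrivial _ tendsto_lim_measure[OF assms(1)]])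
qed

lemma lim_measure_nonneg: "f \<in> X \<Longrightarrow> 0 \<le> lim_measure f E"
  by (rule tendsto_lowerbound[OF tendsto_lim_measure]) (auto simp: U_nontrivial)

lemma lim_measure_points:
  assumes "f \<in> X"
  shows "lim_measure f (\<lambda>n. points (M n)) = 1"
proof -
  have "measure (kern (M n) (f n)) (points (M n)) = 1" for n
    using assms kern[of "f n" n] prob_space.prob_space by (fastforce simp: X_def)
  then show ?thesis by (simp add: lim_measure_def tendsto_Lim[OF U_nontrivial tendsto_const])
qed

lemma lim_measure_empty: "lim_measure f (\<lambda>_. {}) = 0"
  by (simp add: lim_measure_def tendsto_Lim[OF U_nontrivial tendsto_const])

text \<open>Disjoint internal sets have components that are disjoint almost everywhere; there the
  measures add up, and limits along \<open>U\<close> respect sums.\<close>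

lemma lim_measure_Un:
  assumes f: "f \<in> X" and E: "E \<in> EV" "F \<in> EV" and disj: "internal E \<inter> internal F = {}"
  shows "lim_measure f (\<lambda>n. E n \<union> F n) = lim_measure f E + lim_measure f F"
proof -
  have "\<forall>\<^sub>F n in U. E n \<inter> F n = {}"
    using internal_eq_emptyD[OF EV_ops(2)[OF E]] disj by (simp add: internal_Int)
  then have "\<forall>\<^sub>F n in U. measure (kern (M n) (f n)) (E n) + measure (kern (M n) (f n)) (F n)
      = measure (kern (M n) (f n)) (E n \<union> F n)"
  proof eventually_elim
    case (elim n)
    interpret prob_space "kern (M n) (f n)" using f by (intro kern) (auto simp: X_def)
    show ?case using f E elim kern(3)[of "f n" n]
      by (subst finite_measure_Union) (auto simp: X_def EV_def)
  qed
  moreover have "((\<lambda>n. measure (kern (M n) (f n)) (E n) + measure (kern (M n) (f n)) (F n))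
      \<longlongrightarrow> lim_measure f E + lim_measure f F) U"
    using f by (intro tendsto_add tendsto_lim_measure)
  ultimately have "((\<lambda>n. measure (kern (M n) (f n)) (E n \<union> F n))
      \<longlongrightarrow> lim_measure f E + lim_measure f F) U"
    by (rule Lim_transform_eventually[rotated])
  then show ?thesis by (rule tendsto_unique[OF U_nontrivial tendsto_lim_measure[OF f]])
qed

section \<open>The Loeb measure\<close>

text \<open>For a finite additive set function, Caratheodory extension asks only for continuity at
  the empty set. Saturation makes this trivial: a decreasing sequence of internal sets with empty
  intersection is empty from some index on.\<close>

lemma exists_loeb_measure:
  assumes f: "f \<in> X"
  shows "\<exists>\<mu>. (\<forall>E\<in>EV. \<mu> (internal E) = ennreal (lim_measure f E)) \<and>
    measure_space X (sigma_sets X (internal ` EV)) \<mu>"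
proof -
  interpret algebra X "internal ` EV" by (rule algebra_internal)
  \<comment> \<open>The value is read off a chosen representing sequence;
    \<open>lim_measure_cong\<close> makes the choice immaterial.\<close>
  define \<nu> where "\<nu> A = ennreal (lim_measure f (SOME E. E \<in> EV \<and> internal E = A))" for A
  have \<nu>: "\<nu> (internal E) = ennreal (lim_measure f E)" if "E \<in> EV" for E
  proof -
    define F where "F = (SOME F. F \<in> EV \<and> internal F = internal E)"
    have "F \<in> EV \<and> internal F = internal E"
      unfolding F_def by (rule someI[of _ E]) (use that in blast)
    then have "lim_measure f F = lim_measure f E" by (elim conjE lim_measure_cong[OF f _ that])
    then show ?thesis unfolding \<nu>_def F_def by (rule arg_cong)
  qed
  have \<nu>_empty: "\<nu> {} = 0"
    using \<nu>[OF empty_EV] by (simp add: internal_empty lim_measure_empty)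
  have "\<exists>\<mu>. (\<forall>s\<in>internal ` EV. \<mu> s = \<nu> s) \<and> measure_space X (sigma_sets X (internal ` EV)) \<mu>"
  proof (rule caratheodory_empty_continuous)
    show "positive (internal ` EV) \<nu>" by (simp add: positive_def \<nu>_empty)
    show "additive (internal ` EV) \<nu>"
    proof (unfold additive_def, intro ballI impI)
      fix a b assume "a \<in> internal ` EV" "b \<in> internal ` EV" and disj: "a \<inter> b = {}"
      then obtain E F where E: "E \<in> EV" "a = internal E" and F: "F \<in> EV" "b = internal F" by blast
      have "\<nu> (a \<union> b) = ennreal (lim_measure f (\<lambda>n. E n \<union> F n))"
        using \<nu>[OF EV_ops(1)[OF E(1) F(1)]] by (simp add: E F internal_Un)
      then show "\<nu> (a \<union> b) = \<nu> a + \<nu> b"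
        using lim_measure_Un[OF f E(1) F(1)] disj E F f
        by (simp add: \<nu> ennreal_plus lim_measure_nonneg)
    qed
    show "\<nu> a \<noteq> \<infinity>" if "a \<in> internal ` EV" for a by (simp add: \<nu>_def)
    fix A :: "nat \<Rightarrow> (nat \<Rightarrow> 'w) set"
    assume A: "range A \<subseteq> internal ` EV" "decseq A" "(\<Inter>i. A i) = {}"
    then have "\<forall>k. \<exists>E. E \<in> EV \<and> A k = internal E" by blast
    then obtain E where E: "\<And>k. E k \<in> EV" "\<And>k. A k = internal (E k)" by metis
    obtain k where "(\<Inter>j\<le>k. A j) = {}"
      using internal_saturated[of E] E A(3) by auto
    moreover have "A k \<subseteq> (\<Inter>j\<le>k. A j)" using A(2) by (auto simp: decseq_def)
    ultimately have "A k = {}" by blast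
    then have "A i = {}" if "k \<le> i" for i using A(2) that by (auto simp: decseq_def)
    then have "\<forall>\<^sub>F i in sequentially. \<nu> (A i) = 0"
      using \<nu>_empty by (intro eventually_sequentiallyI[of k]) simp
    then show "(\<lambda>i. \<nu> (A i)) \<longlonglongrightarrow> 0" by (rule tendsto_eventually)
  qed
  then show ?thesis using \<nu> by auto
qed

definition S :: "(nat \<Rightarrow> 'w) measure" where
  "S = sigma X (internal ` EV)"

lemma internal_Pow: "internal ` EV \<subseteq> Pow X"
  by (auto simp: internal_def)

lemma space_S: "space S = X" and sets_S: "sets S = sigma_sets X (internal ` EV)"
  using internal_Pow by (auto simp: S_def)

lemma internal_in_sets: "E \<in> EV \<Longrightarrow> internal E \<in> sets S"
  by (auto simp: sets_S)

text \<open>For \<open>f\<close> outside \<open>X\<close> the chosen function may be arbitrary, but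
  \<open>measure_of\<close> still fixes the space and the sets.\<close>

definition loeb :: "(nat \<Rightarrow> 'w) \<Rightarrow> (nat \<Rightarrow> 'w) measure" where
  "loeb f = measure_of X (internal ` EV)
     (SOME \<mu>. (\<forall>E\<in>EV. \<mu> (internal E) = ennreal (lim_measure f E)) \<and>
       measure_space X (sigma_sets X (internal ` EV)) \<mu>)"

lemma sets_loeb: "sets (loeb f) = sets S" and space_loeb: "space (loeb f) = X"
  using internal_Pow by (auto simp: loeb_def sets_S)

lemma emeasure_loeb:
  assumes "f \<in> X" "E \<in> EV"
  shows "emeasure (loeb f) (internal E) = ennreal (lim_measure f E)"
proof -
  define \<mu> where "\<mu> = (SOME \<mu>. (\<forall>E\<in>EV. \<mu> (internal E) = ennreal (lim_measure f E)) \<and>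
       measure_space X (sigma_sets X (internal ` EV)) \<mu>)"
  have \<mu>: "\<forall>E\<in>EV. \<mu> (internal E) = ennreal (lim_measure f E)"
    "measure_space X (sigma_sets X (internal ` EV)) \<mu>"
    using someI_ex[OF exists_loeb_measure[OF assms(1)]] unfolding \<mu>_def by auto
  have "loeb f = measure_of X (internal ` EV) \<mu>" by (simp add: loeb_def \<mu>_def)
  then have "emeasure (loeb f) (internal E) = \<mu> (internal E)"
    using \<mu>(2) assms(2) internal_Pow
    by (intro emeasure_measure_of) (auto simp: measure_space_def sets_loeb internal_in_sets)
  then show ?thesis using \<mu>(1) assms(2) by simp
qed

lemma measure_loeb:
  assumes "f \<in> X" "E \<in> EV"
  shows "measure (loeb f) (internal E) = lim_measure f E"
  using emeasure_loeb[OF assms] lim_measure_nonneg[OF assms(1)] by (simp add: measure_def)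

lemma prob_space_loeb:
  assumes "f \<in> X"
  shows "prob_space (loeb f)"
  using emeasure_loeb[OF assms points_EV]
  by (intro prob_spaceI) (simp add: space_loeb internal_points lim_measure_points[OF assms])

section \<open>Measurability of the limit kernel\<close>

text \<open>Models guarantee this for rationals in the unit interval. Outside it the set is
  everything or empty, so later arguments can use any rational \<open>q\<close>.\<close>

lemma superlevel_in_events:
  assumes "e \<in> events (M n)"
  shows "{w \<in> points (M n). real_of_rat q \<le> measure (kern (M n) w) e} \<in> events (M n)"
proof -
  interpret algebra "points (M n)" "events (M n)" by (rule algebra_events)
  consider "q < 0" | "0 \<le> q" "q \<le> 1" | "1 < q" by linarith
  then show ?thesis
  proof cases
    case 1
    then have "real_of_rat q \<le> measure (kern (M n) w) e" for w
      by (meson measure_nonneg of_rat_less_0_iff less_le_trans less_imp_le)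
    then show ?thesis by simp
  next
    case 2
    have "{w \<in> points (M n). threshold (Prob_rat q) \<le> measure (kern (M n) w) e} \<in> events (M n)"
      using models[of n] assms by (simp add: probability_model_def)
    then show ?thesis by (simp add: threshold_Prob_rat[OF 2])
  next
    case 3
    then have "1 < real_of_rat q" by simp
    then have "\<not> real_of_rat q \<le> measure (kern (M n) w) e" if "w \<in> points (M n)" for w
      using prob_space.prob_le_1[OF kern(1)[OF that], of e] by linarith
    then have "{w \<in> points (M n). real_of_rat q \<le> measure (kern (M n) w) e} = {}" by blast
    then show ?thesis by (simp only: empty_sets)
  qed
qed

text \<open>Each strict superlevel set is a countable union of internal sets. A rational strictly
  below the limit is exceeded almost everywhere; conversely, a lower bound that holds almost
  everywhere passes to the limit, and \<open>a\<close> lies strictly below it.\<close>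

lemma measurable_lim_measure:
  assumes E: "E \<in> EV"
  shows "(\<lambda>f. lim_measure f E) \<in> borel_measurable S"
proof (rule borel_measurable_iff_greater[THEN iffD2], intro allI)
  fix a :: real
  define Q where "Q q n = {w \<in> points (M n). real_of_rat q \<le> measure (kern (M n) w) (E n)}" for q n
  have Q: "Q q \<in> EV" for q
    using E superlevel_in_events by (auto simp: EV_def Q_def)
  have "a < lim_measure f E \<longleftrightarrow> (\<exists>q. a < real_of_rat q \<and> f \<in> internal (Q q))" if f: "f \<in> X" for f
  proof
    assume "a < lim_measure f E"
    then obtain q where q: "a < real_of_rat q" "real_of_rat q < lim_measure f E"
      using of_rat_dense by blast
    have "\<forall>\<^sub>F n in U. real_of_rat q < measure (kern (M n) (f n)) (E n)"
      using order_tendstoD(1)[OF tendsto_lim_measure[OF f] q(2)] .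
    then have "f \<in> internal (Q q)"
      using f by (auto simp: internal_def Q_def X_def elim: eventually_mono)
    with q show "\<exists>q. a < real_of_rat q \<and> f \<in> internal (Q q)" by blast
  next
    assume "\<exists>q. a < real_of_rat q \<and> f \<in> internal (Q q)"
    then obtain q where q: "a < real_of_rat q" "f \<in> internal (Q q)" by blast
    then have "\<forall>\<^sub>F n in U. real_of_rat q \<le> measure (kern (M n) (f n)) (E n)"
      by (auto simp: internal_def Q_def elim: eventually_mono)
    then have "real_of_rat q \<le> lim_measure f E"
      using tendsto_lowerbound[OF tendsto_lim_measure[OF f]] U_nontrivial by blast
    with q show "a < lim_measure f E" by linarith
  qed
  then have "{f \<in> space S. a < lim_measure f E} =
      (\<Union>q\<in>{q. a < real_of_rat q}. internal (Q q))"
    by (auto simp: space_S internal_def)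
  then show "{f \<in> space S. a < lim_measure f E} \<in> sets S"
    using internal_in_sets[OF Q] by (auto intro!: sets.countable_UN')
qed

text \<open>Internal sets are closed under intersection and generate \<open>S\<close>, so
  measurability need only be tested on them, where \<open>loeb\<close> is
  \<open>lim_measure\<close>.\<close>

lemma measurable_loeb: "loeb \<in> S \<rightarrow>\<^sub>M prob_algebra S"
proof (rule measurable_prob_algebra_generated[OF sets_S _ internal_Pow])
  show "Int_stable (internal ` EV)"
    using algebra_internal by (auto simp: Int_stable_def algebra_iff_Int)
  show "prob_space (loeb f)" if "f \<in> space S" for f
    using that prob_space_loeb by (simp add: space_S)
  show "sets (loeb f) = sets S" for f by (rule sets_loeb)
  fix A assume "A \<in> internal ` EV"
  then obtain E where E: "E \<in> EV" "A = internal E" by blast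
  have "(\<lambda>f. ennreal (lim_measure f E)) \<in> borel_measurable S"
    using measurable_lim_measure[OF E(1)] by measurable
  also have "?this \<longleftrightarrow> (\<lambda>f. emeasure (loeb f) A) \<in> borel_measurable S"
    by (rule measurable_cong) (simp add: E space_S emeasure_loeb)
  finally show "(\<lambda>f. emeasure (loeb f) A) \<in> borel_measurable S" .
qed

section \<open>The limit model and preservation of truth\<close>

definition limit_model :: "(nat \<Rightarrow> 'w, 'p) model_data" where
  "limit_model = \<lparr>points = X, events = sets S, kern = loeb,
     val = \<lambda>p. internal (\<lambda>n. val (M n) p)\<rparr>"

lemma probability_model_limit_model: "probability_model limit_model"
  unfolding probability_model_def
proof (intro conjI ballI allI)
  have "\<forall>n. \<exists>w. w \<in> points (M n)" using models unfolding probability_model_def by blast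
  then have "\<exists>f. \<forall>n. f n \<in> points (M n)" by (rule choice)
  then show "points limit_model \<noteq> {}" by (auto simp: limit_model_def X_def)
  show "sigma_algebra (points limit_model) (events limit_model)"
    using sets.sigma_algebra_axioms[of S] by (simp add: limit_model_def space_S)
  fix f assume "f \<in> points limit_model"
  then show "prob_space (kern limit_model f)" by (simp add: limit_model_def prob_space_loeb)
  show "space (kern limit_model f) = points limit_model"
    "sets (kern limit_model f) = events limit_model"
    by (simp_all add: limit_model_def space_loeb sets_loeb)
next
  fix A r assume "A \<in> events limit_model"
  then have [measurable]: "A \<in> sets S" by (simp add: limit_model_def)
  \<comment> \<open>\<open>A\<close> need not be internal, so its superlevel sets come from
    composing the kernel with evaluation at \<open>A\<close>.\<close>
  have "loeb \<in> S \<rightarrow>\<^sub>M subprob_algebra S" by (rule measurable_prob_algebraD[OF measurable_loeb])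
  then have [measurable]: "(\<lambda>f. measure (loeb f) A) \<in> borel_measurable S"
    by (rule measurable_compose) (rule measurable_measure_subprob_algebra, simp)
  have "{f \<in> space S. threshold r \<le> measure (loeb f) A} \<in> sets S" by measurable
  then show "{f \<in> points limit_model. threshold r \<le> measure (kern limit_model f) A}
      \<in> events limit_model"
    by (simp add: limit_model_def space_S)
next
  fix p
  have "(\<lambda>n. val (M n) p) \<in> EV" using models by (auto simp: EV_def probability_model_def)
  then show "val limit_model p \<in> events limit_model"
    by (simp add: limit_model_def internal_in_sets)
qed

text \<open>The converse can fail at \<open>L\<close>, since measures below \<open>r\<close> may
  converge to \<open>r\<close>. Negation is harmless because it occurs only on variables, whose
  valuation is internal.\<close>

lemma sat_limit_model:
  assumes "f \<in> X" "\<forall>\<^sub>F n in U. sat (M n) (f n) \<phi>"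
  shows "sat limit_model f \<phi>"
  using assms
proof (induction \<phi> arbitrary: f)
  case (NegVar p)
  then show ?case
    by (simp add: limit_model_def internal_def ultrafilter_not_eventually[OF ultra])
next
  case (L r \<phi>)
  define E where "E n = {w \<in> points (M n). sat (M n) w \<phi>}" for n
  have E: "E \<in> EV" using models by (auto simp: EV_def E_def sat_set_in_events)
  \<comment> \<open>The truth set of \<phi> in the limit need not be internal. By induction it
    contains the internal set of the truth sets in the \<open>M n\<close>, and monotonicity of the
    measure suffices.\<close>
  have sub: "internal E \<subseteq> {g \<in> X. sat limit_model g \<phi>}"
    by (auto simp: internal_def E_def eventually_conj_iff intro: L.IH)
  have "{g \<in> X. sat limit_model g \<phi>} \<in> sets (loeb f)"
    using sat_set_in_events[OF probability_model_limit_model, of \<phi>]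
    by (simp add: limit_model_def sets_loeb)
  then have "measure (loeb f) (internal E) \<le> measure (loeb f) {g \<in> X. sat limit_model g \<phi>}"
    using sub prob_space.finite_measure[OF prob_space_loeb[OF L.prems(1)]]
    by (intro finite_measure.finite_measure_mono)
  moreover have "threshold r \<le> lim_measure f E"
    by (rule tendsto_lowerbound[OF tendsto_lim_measure])
      (use L.prems U_nontrivial in \<open>auto simp: E_def\<close>)
  ultimately show ?case
    using measure_loeb[OF L.prems(1) E] by (simp add: limit_model_def)
qed (auto simp: limit_model_def internal_def eventually_conj_iff
    ultrafilter_eventually_disj[OF ultra])

end

section \<open>Countability of the language and the compactness theorem\<close>

instance prob_rat :: countable
proof
  have "inj (to_nat \<circ> rat_of_prob_rat)"
    by (intro inj_compose inj_to_nat) (simp add: inj_def rat_of_prob_rat_inject)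
  then show "\<exists>f :: prob_rat \<Rightarrow> nat. inj f" by blast
qed

instance bpl :: (countable) countable
  by countable_datatype

theorem theorem2p5:
  fixes \<Gamma> :: "'p::countable bpl set"
  shows "satisfiable \<Gamma> \<longleftrightarrow> (\<forall>\<Delta>. \<Delta> \<subseteq> \<Gamma> \<and> finite \<Delta> \<longrightarrow> satisfiable \<Delta>)"
proof
  assume "satisfiable \<Gamma>"
  then show "\<forall>\<Delta>. \<Delta> \<subseteq> \<Gamma> \<and> finite \<Delta> \<longrightarrow> satisfiable \<Delta>"
    unfolding satisfiable_def satisfiable_over_def by blast
next
  assume fin: "\<forall>\<Delta>. \<Delta> \<subseteq> \<Gamma> \<and> finite \<Delta> \<longrightarrow> satisfiable \<Delta>"
  \<comment> \<open>Injectivity of the coding makes each segment finite, and \<phi> belongs to every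
    segment from its own code on.\<close>
  define \<Delta> where "\<Delta> n = {\<phi> \<in> \<Gamma>. to_nat \<phi> \<le> n}" for n
  have "finite (\<Delta> n)" for n
  proof (rule finite_imageD)
    show "finite (to_nat ` \<Delta> n)" by (rule finite_subset[of _ "{..n}"]) (auto simp: \<Delta>_def)
  qed (rule inj_on_subset[OF inj_to_nat subset_UNIV])
  then have "satisfiable (\<Delta> n)" for n using fin by (simp add: \<Delta>_def)
  then have "\<forall>n. \<exists>(M :: ('p bpl set, 'p) model_data) w.
      probability_model M \<and> w \<in> points M \<and> (\<forall>\<phi>\<in>\<Delta> n. sat M w \<phi>)"
    unfolding satisfiable_def satisfiable_over_def by blast
  then obtain M :: "nat \<Rightarrow> ('p bpl set, 'p) model_data" and f where
    M: "\<And>n. probability_model (M n)" and f: "\<And>n. f n \<in> points (M n)"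
    and sat_f: "\<And>n \<phi>. \<phi> \<in> \<Delta> n \<Longrightarrow> sat (M n) (f n) \<phi>"
    by metis
  obtain U :: "nat filter" where U: "U \<le> sequentially" "ultrafilter U"
    using exists_ultrafilter_le[OF sequentially_bot] by blast
  interpret model_ultraproduct U M by standard (use M U in auto)
  have "f \<in> X" using f by (simp add: X_def)
  moreover have "sat limit_model f \<phi>" if "\<phi> \<in> \<Gamma>" for \<phi>
  proof (rule sat_limit_model[OF \<open>f \<in> X\<close>])
    have "\<forall>\<^sub>F n in U. to_nat \<phi> \<le> n"
      using U(1) eventually_ge_at_top by (rule filter_leD)
    then show "\<forall>\<^sub>F n in U. sat (M n) (f n) \<phi>"
      by eventually_elim (use that in \<open>auto simp: \<Delta>_def intro: sat_f\<close>)
  qed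
  \<comment> \<open>The limit model lives on sequences of sets of formulas, so the transfer between
    point types has to bring it back to the type used in \<open>satisfiable\<close>.\<close>
  ultimately have "satisfiable_over TYPE(nat \<Rightarrow> 'p bpl set) \<Gamma>"
    using probability_model_limit_model unfolding satisfiable_over_def
    by (intro exI[of _ limit_model] exI[of _ f]) (simp add: limit_model_def)
  then show "satisfiable \<Gamma>" by (rule satisfiable_over_imp_satisfiable)
qed

end
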